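(* Let $\alpha\in(0,1)$ and let $(\mathcal X_i)_{i\in\mathbb N}$ be monotone conflict sets. Let $(\gamma_i)_{i\in\mathbb N}$ be a non-negative sequence that sums to $1$ and, for every $j\in\mathbb N$, let $(g^*_{j,i})_{i=j+1}^\infty$ be a non-negative sequence such that $g^*_{j,i}=0$ if $j\in\mathcal X_i$ and $\sum_{i>j,\,j\notin\mathcal X_i}g^*_{j,i}\le1$. Let $\gamma_i$, $g^*_{j,i}$ ($j<i$), $\tau_i\in(0,1]$ and $\lambda_i\in[0,\tau_i)$ be measurable with respect to $\mathcal G_{-\mathcal X_i}=\sigma(\{P_j: j<i,\ j\notin\mathcal X_i\})$ for every $i\in\mathbb N$, and put $S_i=\mathbf 1\{P_i\le\tau_i\}$, $C_i=\mathbf 1\{P_i\le\lambda_i\}$. Then, in the online testing setting described in the context, the procedure (the $\text{ADDIS-Graph}_{\text{conf}}$) that rejects $H_i$ if and only if $P_i\le\alpha_i$, where $$\alpha_i=(\tau_i-\lambda_i)\left(\alpha\gamma_i+\sum_{j=1}^{i-1}g^*_{j,i}\,(C_j-S_j+1)\,\frac{\alpha_j}{\tau_j-\lambda_j}\right),\qquad i\in\mathbb N,$$ controls the familywise error rate strongly at level $\alpha$, i.e. $\mathrm{FWER}\le\alpha$ for every configuration of true and false null hypotheses.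
   Context: Online testing setting: $(H_i)_{i\in\mathbb N}$ is a sequence of null hypotheses with p-values $(P_i)_{i\in\mathbb N}$, random variables with values in $[0,1]$. $I_0\subseteq\mathbb N$ is the index set of true null hypotheses. Each null p-value $P_i$, $i\in I_0$, is valid: $\mathbb P(P_i\le x)\le x$ for all $x\in[0,1]$. Moreover, unless $\tau_i=1$, the null p-value $P_i$, $i\in I_0$, is assumed uniformly valid: $\mathbb P(P_i\le xy\mid P_i\le y)\le x$ for all $x,y\in[0,1]$ (i.e. $\mathbb P(P_i\le xy)\le x\,\mathbb P(P_i\le y)$). Conflict sets: for each $i$, $\mathcal X_i\subseteq\{1,\dots,i-1\}$ is a fixed set containing all indices of previous p-values that are not stochastically independent of $P_i$ (and possibly further indices); that is, $P_i$ is independent of the $\sigma$-algebra $\mathcal G_{-\mathcal X_i}=\sigma(\{P_j:j<i,\ j\notin\mathcal X_i\})$. The conflict sets are monotone: $j\in\mathcal X_i$ implies $j\in\mathcal X_k$ for all $k\in\{j+1,\dots,i-1\}$. The familywise error rate is $\mathrm{FWER}=\mathbb P(\exists\, i\in I_0: P_i\le\alpha_i)$, where $\mathbb P$ is the probability under the true configuration of true and false hypotheses. *)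

theory Defs
  imports "HOL-Probability.Probability"
begin

text \<open>
  Hypotheses are indexed by the positive natural numbers; p-values and procedure parameters are
  real random variables on the probability space \<open>M\<close>, and values at index \<open>0\<close> are never used.
\<close>

definition valid_pval :: "'a measure \<Rightarrow> ('a \<Rightarrow> real) \<Rightarrow> bool" where
  "valid_pval M p \<longleftrightarrow> (\<forall>x\<in>{0..1}. \<P>(\<omega> in M. p \<omega> \<le> x) \<le> x)"

text \<open>
  When the event \<open>p \<le> y\<close> has probability \<open>0\<close>, the library's conditional probability is \<open>0\<close>, so the
  condition holds trivially there, just as \<open>P(p \<le> x y) \<le> x P(p \<le> y)\<close> does.
\<close>

definition uniformly_valid_pval :: "'a measure \<Rightarrow> ('a \<Rightarrow> real) \<Rightarrow> bool" where
  "uniformly_valid_pval M p \<longleftrightarrow>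
     (\<forall>x\<in>{0..1}. \<forall>y\<in>{0..1}. \<P>(\<omega> in M. p \<omega> \<le> x * y \<bar> p \<omega> \<le> y) \<le> x)"

definition conflict_sets :: "(nat \<Rightarrow> nat set) \<Rightarrow> bool" where
  "conflict_sets X \<longleftrightarrow> (\<forall>i\<ge>1. X i \<subseteq> {1..<i})"

definition monotone_conflict_sets :: "(nat \<Rightarrow> nat set) \<Rightarrow> bool" where
  "monotone_conflict_sets X \<longleftrightarrow> conflict_sets X \<and>
     (\<forall>i\<ge>1. \<forall>j\<in>X i. \<forall>k\<in>{j<..<i}. j \<in> X k)"

text \<open>
  The sigma-algebra generated by \<open>P j\<close> for \<open>j < i\<close> outside \<open>X i\<close>. It is the trivial sigma-algebra on
  \<open>space M\<close> if there are no such \<open>j\<close>; a supremum of measures would have empty space in that case.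
\<close>

definition nonconflict_algebra ::
  "'a measure \<Rightarrow> (nat \<Rightarrow> 'a \<Rightarrow> real) \<Rightarrow> (nat \<Rightarrow> nat set) \<Rightarrow> nat \<Rightarrow> 'a measure" where
  "nonconflict_algebra M P X i =
     sigma (space M) {P j -` A \<inter> space M | j A. j \<in> {1..<i} - X i \<and> A \<in> sets borel}"

fun addis_graph_conf ::
  "real \<Rightarrow> (nat \<Rightarrow> 'a \<Rightarrow> real) \<Rightarrow> (nat \<Rightarrow> 'a \<Rightarrow> real) \<Rightarrow> (nat \<Rightarrow> nat \<Rightarrow> 'a \<Rightarrow> real) \<Rightarrow>
   (nat \<Rightarrow> 'a \<Rightarrow> real) \<Rightarrow> (nat \<Rightarrow> 'a \<Rightarrow> real) \<Rightarrow> nat \<Rightarrow> 'a \<Rightarrow> real" where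
  "addis_graph_conf \<alpha> P \<gamma> g \<tau> lam i \<omega> =
     (\<tau> i \<omega> - lam i \<omega>) *
     (\<alpha> * \<gamma> i \<omega> +
      (\<Sum>j = 1..<i. g j i \<omega> * (of_bool (P j \<omega> \<le> lam j \<omega>) - of_bool (P j \<omega> \<le> \<tau> j \<omega>) + 1) *
         (addis_graph_conf \<alpha> P \<gamma> g \<tau> lam j \<omega> / (\<tau> j \<omega> - lam j \<omega>))))"

declare addis_graph_conf.simps [simp del]

definition fwer :: "'a measure \<Rightarrow> (nat \<Rightarrow> 'a \<Rightarrow> real) \<Rightarrow> nat set \<Rightarrow> (nat \<Rightarrow> 'a \<Rightarrow> real) \<Rightarrow> real" where
  "fwer M P I0 a = \<P>(\<omega> in M. \<exists>i\<in>I0. P i \<omega> \<le> a i \<omega>)"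

end

theory Submission
  imports Defs
begin

text \<open>
  Write \<open>b i = \<alpha> i / (\<tau> i - lam i)\<close>. The weights \<open>b\<close> describe a flow of total mass at most \<open>\<alpha>\<close> on a
  directed acyclic graph in which node \<open>j\<close> absorbs its mass exactly if \<open>lam j < P j \<le> \<tau> j\<close> and passes
  it on otherwise. Hence the absorbed mass is at most \<open>\<alpha>\<close>, and so is each single \<open>b n\<close>. Monotone
  conflict sets make \<open>b i\<close> measurable with respect to an algebra independent of \<open>P i\<close>, and uniform
  validity then bounds the probability of a false rejection of \<open>H i\<close> by the expected mass absorbed
  at \<open>i\<close>. A union bound concludes the argument.
\<close>

section \<open>Mass balance of a flow on the graph\<close>

text \<open>Summing the recursion over \<open>i \<le> n\<close> counts what enters each node.
  Regrouped by source, node \<open>j\<close> sends out at most \<open>w j * b j\<close>, because its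
  outgoing weights add up to at most 1. Subtracting this from the total leaves the share
  \<open>1 - w j\<close> kept at each \<open>j < n\<close>. Node \<open>n\<close> counts in full,
  since its outgoing edges lie beyond the horizon.\<close>

lemma flow_bound:
  fixes b c w :: "nat \<Rightarrow> real" and g :: "nat \<Rightarrow> nat \<Rightarrow> real"
  assumes b: "\<And>i. i \<in> {1..n} \<Longrightarrow> b i = c i + (\<Sum>j=1..<i. g j i * w j * b j)"
    and nonneg: "\<And>j. j \<in> {1..<n} \<Longrightarrow> 0 \<le> w j * b j"
    and c: "(\<Sum>i=1..n. c i) \<le> \<alpha>"
    and g: "\<And>j. j \<in> {1..<n} \<Longrightarrow> (\<Sum>i\<in>{j<..n}. g j i) \<le> 1"
    and n: "n \<ge> 1"
  shows "(\<Sum>i=1..<n. (1 - w i) * b i) + b n \<le> \<alpha>"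
proof -
  have "(\<Sum>i=1..n. \<Sum>j=1..<i. g j i * w j * b j)
      = (\<Sum>(i, j)\<in>Sigma {1..n} (\<lambda>i. {1..<i}). g j i * w j * b j)"
    by (subst sum.Sigma) auto
  \<comment> \<open>The edges \<open>j < i\<close> are regrouped by source. A source
    \<open>j\<close> needs a target \<open>i\<close> with \<open>j < i \<le> n\<close>, hence the
    range \<open>{1..<n}\<close>.\<close>
  also have "\<dots> = (\<Sum>(j, i)\<in>Sigma {1..<n} (\<lambda>j. {j<..n}). g j i * w j * b j)"
    by (rule sum.reindex_bij_witness[of _ prod.swap prod.swap]) auto
  also have "\<dots> = (\<Sum>j=1..<n. \<Sum>i\<in>{j<..n}. g j i * w j * b j)"
    by (subst sum.Sigma) auto
  also have "\<dots> = (\<Sum>j=1..<n. (\<Sum>i\<in>{j<..n}. g j i) * (w j * b j))"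
    by (simp add: sum_distrib_right mult.assoc)
  also have "\<dots> \<le> (\<Sum>j=1..<n. 1 * (w j * b j))"
    by (intro sum_mono mult_right_mono g nonneg)
  finally have "(\<Sum>i=1..n. b i) \<le> \<alpha> + (\<Sum>j=1..<n. w j * b j)"
    using b c by (simp add: sum.distrib)
  moreover have "(\<Sum>i=1..n. b i) = (\<Sum>i=1..<n. b i) + b n"
    using n by (simp add: sum.last_plus atLeastLessThanSuc_atLeastAtMost[symmetric])
  ultimately show ?thesis
    by (simp add: left_diff_distrib sum_subtractf)
qed

section \<open>Freezing independent arguments\<close>

text \<open>Independence makes the joint law of \<open>X\<close> and \<open>Y\<close> agree with the
  product law on rectangles, hence everywhere, and Tonelli's theorem splits the integral. Quantities
  known to \<open>G\<close> can thus be held constant while integrating over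
  \<open>X\<close>.\<close>

lemma (in prob_space) nn_integral_indep_set:
  assumes indep: "indep_set (sets (vimage_algebra (space M) X S)) (sets G)"
    and G: "subalgebra M G"
    and X[measurable]: "X \<in> M \<rightarrow>\<^sub>M S" and Y: "Y \<in> G \<rightarrow>\<^sub>M T"
    and f[measurable]: "f \<in> borel_measurable (S \<Otimes>\<^sub>M T)"
  shows "(\<integral>\<^sup>+\<omega>. f (X \<omega>, Y \<omega>) \<partial>M) = (\<integral>\<^sup>+\<omega>'. \<integral>\<^sup>+\<omega>. f (X \<omega>, Y \<omega>') \<partial>M \<partial>M)"
proof -
  have [measurable]: "Y \<in> M \<rightarrow>\<^sub>M T"
    using G Y by (rule measurable_from_subalg)
  interpret X: prob_space "distr M S X" by (rule prob_space_distr) simp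
  interpret Y: prob_space "distr M T Y" by (rule prob_space_distr) simp
  interpret XY: pair_sigma_finite "distr M S X" "distr M T Y" ..
  have joint: "distr M S X \<Otimes>\<^sub>M distr M T Y = distr M (S \<Otimes>\<^sub>M T) (\<lambda>\<omega>. (X \<omega>, Y \<omega>))"
  proof (rule pair_measure_eqI)
    fix A B assume "A \<in> sets (distr M S X)" "B \<in> sets (distr M T Y)"
    then have [measurable]: "A \<in> sets S" "B \<in> sets T" by auto
    have "prob ((X -` A \<inter> space M) \<inter> (Y -` B \<inter> space M))
        = prob (X -` A \<inter> space M) * prob (Y -` B \<inter> space M)"
    proof (rule indep_setD[OF indep])
      show "X -` A \<inter> space M \<in> sets (vimage_algebra (space M) X S)"
        by (rule in_vimage_algebra) simp
      show "Y -` B \<inter> space M \<in> sets G"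
        using measurable_sets[OF Y, of B] G by (simp add: subalgebra_def)
    qed
    moreover have "(X -` A \<inter> space M) \<inter> (Y -` B \<inter> space M)
        = (\<lambda>\<omega>. (X \<omega>, Y \<omega>)) -` (A \<times> B) \<inter> space M"
      by auto
    ultimately show "emeasure (distr M S X) A * emeasure (distr M T Y) B
        = emeasure (distr M (S \<Otimes>\<^sub>M T) (\<lambda>\<omega>. (X \<omega>, Y \<omega>))) (A \<times> B)"
      by (simp add: emeasure_distr emeasure_eq_measure ennreal_mult[symmetric])
  qed (simp_all add: X.sigma_finite_measure_axioms Y.sigma_finite_measure_axioms
      cong: sets_pair_measure_cong)
  have "(\<integral>\<^sup>+\<omega>. f (X \<omega>, Y \<omega>) \<partial>M) = (\<integral>\<^sup>+z. f z \<partial>distr M (S \<Otimes>\<^sub>M T) (\<lambda>\<omega>. (X \<omega>, Y \<omega>)))"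
    by (subst nn_integral_distr) auto
  also have "\<dots> = (\<integral>\<^sup>+y. \<integral>\<^sup>+x. f (x, y) \<partial>distr M S X \<partial>distr M T Y)"
    unfolding joint[symmetric] by (subst XY.nn_integral_snd[symmetric]) auto
  also have "\<dots> = (\<integral>\<^sup>+\<omega>'. \<integral>\<^sup>+x. f (x, Y \<omega>') \<partial>distr M S X \<partial>M)"
    by (subst nn_integral_distr) auto
  also have "\<dots> = (\<integral>\<^sup>+\<omega>'. \<integral>\<^sup>+\<omega>. f (X \<omega>, Y \<omega>') \<partial>M \<partial>M)"
    by (intro nn_integral_cong nn_integral_distr) auto
  finally show ?thesis .
qed

section \<open>From validity of a p-value to absorbed mass\<close>

lemma (in prob_space) uniformly_valid_pvalD:
  assumes [measurable]: "p \<in> borel_measurable M"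
    and "uniformly_valid_pval M p" and xy: "x \<in> {0..1}" "y \<in> {0..1}"
  shows "\<P>(\<omega> in M. p \<omega> \<le> x * y) \<le> x * \<P>(\<omega> in M. p \<omega> \<le> y)"
proof -
  have le: "x * y \<le> y"
    using xy by (simp add: mult_left_le_one_le)
  then have eq: "\<P>(\<omega> in M. p \<omega> \<le> x * y \<and> p \<omega> \<le> y) = \<P>(\<omega> in M. p \<omega> \<le> x * y)"
    by (intro arg_cong[where f = prob]) auto
  have "\<P>(\<omega> in M. p \<omega> \<le> x * y) / \<P>(\<omega> in M. p \<omega> \<le> y) \<le> x"
    using assms(2)[unfolded uniformly_valid_pval_def cond_prob_def, rule_format, OF xy]
    unfolding eq .
  \<comment> \<open>This settles the case where \<open>p \<omega> \<le> y\<close> is a null event: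
    division by zero then makes the quotient 0, and the preceding bound carries no
    information.\<close>
  moreover have "\<P>(\<omega> in M. p \<omega> \<le> x * y) \<le> \<P>(\<omega> in M. p \<omega> \<le> y)"
    using le by (intro finite_measure_mono) auto
  ultimately show ?thesis
    by (cases "\<P>(\<omega> in M. p \<omega> \<le> y) = 0")
      (auto simp: divide_le_eq zero_less_measure_iff order_antisym split: if_splits)
qed

text \<open>The case of constant thresholds. With \<open>q\<close> the distribution function of
  \<open>p\<close>, the scaling \<open>q (x * t) \<le> x * q t\<close> is used twice. At
  \<open>x = l / t\<close> it shows that at least the fraction \<open>1 - l / t\<close> of the mass
  \<open>q t\<close> lies above \<open>l\<close>; at \<open>x = (1 - l / t) * b\<close> it bounds
  the rejection probability by \<open>b\<close> times that same fraction of
  \<open>q t\<close>.\<close>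

lemma (in prob_space) prob_le_absorption:
  assumes [measurable]: "p \<in> borel_measurable M"
    and range: "\<And>\<omega>. \<omega> \<in> space M \<Longrightarrow> p \<omega> \<in> {0..1}"
    and valid: "uniformly_valid_pval M p \<or> t = 1 \<and> valid_pval M p"
    and t: "0 < t" "t \<le> 1" and l: "0 \<le> l" "l < t" and b: "0 \<le> b" "b \<le> 1"
  shows "\<P>(\<omega> in M. p \<omega> \<le> (t - l) * b) \<le> b * \<P>(\<omega> in M. l < p \<omega> \<and> p \<omega> \<le> t)"
proof -
  define q where "q x = \<P>(\<omega> in M. p \<omega> \<le> x)" for x
  have scale: "q (x * t) \<le> x * q t" if "x \<in> {0..1}" for x
    using valid
  proof
    assume "uniformly_valid_pval M p"
    then show ?thesis using uniformly_valid_pvalD that t unfolding q_def by simp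
  next
    \<comment> \<open>At \<open>t = 1\<close> plain validity already is the scaling inequality,
      since values in the unit interval force \<open>q 1 = 1\<close>.\<close>
    assume *: "t = 1 \<and> valid_pval M p"
    have "q 1 = 1"
      unfolding q_def using range by (subst prob_Collect_eq_1) auto
    with * that show ?thesis by (auto simp: valid_pval_def q_def)
  qed
  have "q l \<le> l / t * q t"
    using scale[of "l / t"] t l by simp
  moreover have "q t = q l + \<P>(\<omega> in M. l < p \<omega> \<and> p \<omega> \<le> t)"
    unfolding q_def using l by (subst finite_measure_Union[symmetric]) (auto intro!: arg_cong[where f = prob])
  ultimately have "(1 - l / t) * q t \<le> \<P>(\<omega> in M. l < p \<omega> \<and> p \<omega> \<le> t)"
    by (simp add: algebra_simps)
  then have "b * ((1 - l / t) * q t) \<le> b * \<P>(\<omega> in M. l < p \<omega> \<and> p \<omega> \<le> t)"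
    using b by (intro mult_left_mono)
  moreover have "q ((1 - l / t) * b * t) \<le> (1 - l / t) * b * q t"
    using t l b by (intro scale) (auto intro!: mult_le_one mult_nonneg_nonneg)
  moreover have "(1 - l / t) * b * t = (t - l) * b"
    using t by (simp add: field_simps)
  ultimately have "q ((t - l) * b) \<le> b * \<P>(\<omega> in M. l < p \<omega> \<and> p \<omega> \<le> t)"
    by (simp only: mult_ac)
  then show ?thesis by (simp only: q_def)
qed

text \<open>Random thresholds reduce to constant ones by freezing \<open>t\<close>, \<open>l\<close>
  and \<open>b\<close>, which are known to \<open>G\<close> and hence independent of
  \<open>p\<close>. The bound \<open>prob_le_absorption\<close> applies to almost every frozen
  value, and the freezing is then undone on the larger side.\<close>

lemma (in prob_space) prob_rejection_le:
  assumes indep: "indep_set (sets (vimage_algebra (space M) p borel)) (sets G)"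
    and G: "subalgebra M G"
    and p[measurable]: "p \<in> borel_measurable M"
    and range: "\<And>\<omega>. \<omega> \<in> space M \<Longrightarrow> p \<omega> \<in> {0..1}"
    and valid: "uniformly_valid_pval M p \<or> (AE \<omega> in M. t \<omega> = 1) \<and> valid_pval M p"
    and meas: "t \<in> borel_measurable G" "l \<in> borel_measurable G" "b \<in> borel_measurable G"
    and t: "\<And>\<omega>. \<omega> \<in> space M \<Longrightarrow> t \<omega> \<in> {0<..1}"
    and l: "\<And>\<omega>. \<omega> \<in> space M \<Longrightarrow> l \<omega> \<in> {0..<t \<omega>}"
    and b: "\<And>\<omega>. \<omega> \<in> space M \<Longrightarrow> b \<omega> \<in> {0..1}"
  shows "emeasure M {\<omega>\<in>space M. p \<omega> \<le> (t \<omega> - l \<omega>) * b \<omega>}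
    \<le> (\<integral>\<^sup>+\<omega>. ennreal (of_bool (l \<omega> < p \<omega> \<and> p \<omega> \<le> t \<omega>) * b \<omega>) \<partial>M)"
proof -
  define Y where "Y \<omega> = (t \<omega>, l \<omega>, b \<omega>)" for \<omega>
  define f :: "real \<times> real \<times> real \<times> real \<Rightarrow> ennreal"
    where "f = (\<lambda>(x, t, l, b). of_bool (x \<le> (t - l) * b))"
  define h :: "real \<times> real \<times> real \<times> real \<Rightarrow> ennreal"
    where "h = (\<lambda>(x, t, l, b). ennreal (of_bool (l < x \<and> x \<le> t) * b))"
  have [measurable]: "f \<in> borel_measurable (borel \<Otimes>\<^sub>M borel \<Otimes>\<^sub>M borel \<Otimes>\<^sub>M borel)"
    "h \<in> borel_measurable (borel \<Otimes>\<^sub>M borel \<Otimes>\<^sub>M borel \<Otimes>\<^sub>M borel)"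
    unfolding f_def h_def of_bool_def by measurable
  note [measurable] = meas[THEN measurable_from_subalg[OF G]]
  have Y: "Y \<in> G \<rightarrow>\<^sub>M borel \<Otimes>\<^sub>M borel \<Otimes>\<^sub>M borel"
    unfolding Y_def using meas by measurable
  have "emeasure M {\<omega>\<in>space M. p \<omega> \<le> (t \<omega> - l \<omega>) * b \<omega>} 
      = (\<integral>\<^sup>+\<omega>. indicator {\<omega>\<in>space M. p \<omega> \<le> (t \<omega> - l \<omega>) * b \<omega>} \<omega> \<partial>M)"
    by simp
  also have "\<dots> = (\<integral>\<^sup>+\<omega>. f (p \<omega>, Y \<omega>) \<partial>M)"
    by (auto simp: f_def Y_def indicator_def intro!: nn_integral_cong)
  also have "\<dots> = (\<integral>\<^sup>+\<omega>'. \<integral>\<^sup>+\<omega>. f (p \<omega>, Y \<omega>') \<partial>M \<partial>M)"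
    by (rule nn_integral_indep_set[OF indep G p Y]) simp
  also have "\<dots> \<le> (\<integral>\<^sup>+\<omega>'. \<integral>\<^sup>+\<omega>. h (p \<omega>, Y \<omega>') \<partial>M \<partial>M)"
  \<comment> \<open>The comparison is only almost everywhere: without uniform validity,
    \<open>t = 1\<close> may fail on a null set.\<close>
  proof (rule nn_integral_mono_AE)
    have "AE \<omega> in M. uniformly_valid_pval M p \<or> t \<omega> = 1 \<and> valid_pval M p"
      using valid by auto
    with AE_space show "AE \<omega>' in M. (\<integral>\<^sup>+\<omega>. f (p \<omega>, Y \<omega>') \<partial>M) \<le> (\<integral>\<^sup>+\<omega>. h (p \<omega>, Y \<omega>') \<partial>M)"
    proof eventually_elim
      case (elim \<omega>')
      have "(\<integral>\<^sup>+\<omega>. f (p \<omega>, Y \<omega>') \<partial>M)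
          = (\<integral>\<^sup>+\<omega>. indicator {\<omega>\<in>space M. p \<omega> \<le> (t \<omega>' - l \<omega>') * b \<omega>'} \<omega> \<partial>M)"
        by (auto simp: f_def Y_def indicator_def intro!: nn_integral_cong)
      also have "\<dots> = ennreal (\<P>(\<omega> in M. p \<omega> \<le> (t \<omega>' - l \<omega>') * b \<omega>'))"
        by (simp add: emeasure_eq_measure)
      also have "\<dots> \<le> ennreal (b \<omega>' * \<P>(\<omega> in M. l \<omega>' < p \<omega> \<and> p \<omega> \<le> t \<omega>'))"
        using elim t[of \<omega>'] l[of \<omega>'] b[of \<omega>'] range
        by (intro ennreal_leI prob_le_absorption) auto
      also have "\<dots> = ennreal (b \<omega>')
          * (\<integral>\<^sup>+\<omega>. indicator {\<omega>\<in>space M. l \<omega>' < p \<omega> \<and> p \<omega> \<le> t \<omega>'} \<omega> \<partial>M)"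
        using b[of \<omega>'] elim by (simp add: emeasure_eq_measure ennreal_mult)
      also have "\<dots> = (\<integral>\<^sup>+\<omega>. ennreal (b \<omega>')
          * indicator {\<omega>\<in>space M. l \<omega>' < p \<omega> \<and> p \<omega> \<le> t \<omega>'} \<omega> \<partial>M)"
        by (subst nn_integral_cmult) auto
      also have "\<dots> = (\<integral>\<^sup>+\<omega>. h (p \<omega>, Y \<omega>') \<partial>M)"
        by (auto simp: h_def Y_def indicator_def intro!: nn_integral_cong)
      finally show ?case .
    qed
  qed
  also have "\<dots> = (\<integral>\<^sup>+\<omega>. h (p \<omega>, Y \<omega>) \<partial>M)"
    by (rule nn_integral_indep_set[OF indep G p Y, symmetric]) simp
  finally show ?thesis by (simp add: h_def Y_def)
qed

section \<open>Algebras of non-conflicting p-values\<close>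

lemma space_nonconflict_algebra: "space (nonconflict_algebra M P X i) = space M"
  unfolding nonconflict_algebra_def by (subst space_measure_of) auto

lemma sets_nonconflict_algebra:
  "sets (nonconflict_algebra M P X i)
    = sigma_sets (space M) {P j -` A \<inter> space M | j A. j \<in> {1..<i} - X i \<and> A \<in> sets borel}"
  unfolding nonconflict_algebra_def by (subst sets_measure_of) auto

lemma subalgebra_nonconflict_algebra:
  assumes "\<And>i. i \<ge> 1 \<Longrightarrow> P i \<in> borel_measurable M"
  shows "subalgebra M (nonconflict_algebra M P X i)"
  unfolding subalgebra_def space_nonconflict_algebra sets_nonconflict_algebra using assms
  by (intro conjI refl sets.sigma_sets_subset) (auto intro!: measurable_sets)

lemma measurable_nonconflict_algebra:
  assumes "j \<in> {1..<i} - X i"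
  shows "P j \<in> borel_measurable (nonconflict_algebra M P X i)"
  using assms unfolding measurable_def space_nonconflict_algebra sets_nonconflict_algebra
  by (auto intro!: sigma_sets.Basic)

text \<open>This is where monotonicity of the conflict sets enters: an index \<open>k < j\<close> in
  \<open>X i\<close> would also lie in \<open>X j\<close>, because \<open>k < j < i\<close>. So
  every generator for \<open>j\<close> is one for \<open>i\<close>.\<close>

lemma nonconflict_algebra_mono:
  assumes mono: "monotone_conflict_sets X" and j: "j \<in> {1..<i} - X i"
  shows "sets (nonconflict_algebra M P X j) \<subseteq> sets (nonconflict_algebra M P X i)"
  unfolding sets_nonconflict_algebra
proof (rule sigma_sets_mono')
  have "{1..<j} - X j \<subseteq> {1..<i} - X i"
  proof
    fix k assume k: "k \<in> {1..<j} - X j"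
    then have "k \<notin> X i"
      using mono j unfolding monotone_conflict_sets_def by (auto dest!: spec[of _ i])
    with j k show "k \<in> {1..<i} - X i" by auto
  qed
  then show "{P k -` A \<inter> space M | k A. k \<in> {1..<j} - X j \<and> A \<in> sets borel}
      \<subseteq> {P k -` A \<inter> space M | k A. k \<in> {1..<i} - X i \<and> A \<in> sets borel}"
    by blast
qed

lemma borel_measurable_nonconflict_algebra_mono:
  assumes "f \<in> borel_measurable (nonconflict_algebra M P X j)"
    and "monotone_conflict_sets X" "j \<in> {1..<i} - X i"
  shows "f \<in> borel_measurable (nonconflict_algebra M P X i)"
  using assms nonconflict_algebra_mono[OF assms(2,3), of M P] unfolding measurable_def
  by (auto simp: space_nonconflict_algebra)

section \<open>Control of the familywise error rate\<close>

text \<open>Control is strong because \<open>I0\<close> is arbitrary. The exception for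
  \<open>\<tau> i = 1\<close> is read almost surely. Summability of \<open>g\<close> is stated
  separately because an infinite sum without a value defaults to 0, so \<open>g_sum\<close> alone
  would not bound the partial sums.\<close>

theorem corollary4p1:
  fixes M :: "'a measure"
    and P :: "nat \<Rightarrow> 'a \<Rightarrow> real"
    and I0 :: "nat set"
    and X :: "nat \<Rightarrow> nat set"
    and \<alpha> :: real
    and \<gamma> \<tau> lam :: "nat \<Rightarrow> 'a \<Rightarrow> real"
    and g :: "nat \<Rightarrow> nat \<Rightarrow> 'a \<Rightarrow> real"
  assumes "prob_space M"
    and pval_rv: "\<And>i. i \<ge> 1 \<Longrightarrow> P i \<in> borel_measurable M"
    and pval_range: "\<And>i \<omega>. i \<ge> 1 \<Longrightarrow> \<omega> \<in> space M \<Longrightarrow> P i \<omega> \<in> {0..1}"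
    and nulls: "I0 \<subseteq> {1..}"
    and null_valid: "\<And>i. i \<in> I0 \<Longrightarrow> valid_pval M (P i)"
    and null_uniformly_valid:
      "\<And>i. i \<in> I0 \<Longrightarrow> \<not> (AE \<omega> in M. \<tau> i \<omega> = 1) \<Longrightarrow> uniformly_valid_pval M (P i)"
    and monotone: "monotone_conflict_sets X"
    and indep: "\<And>i. i \<ge> 1 \<Longrightarrow>
      prob_space.indep_set M (sets (vimage_algebra (space M) (P i) borel))
        (sets (nonconflict_algebra M P X i))"
    and \<alpha>: "\<alpha> \<in> {0<..<1}"
    and \<gamma>_nonneg: "\<And>i \<omega>. i \<ge> 1 \<Longrightarrow> \<omega> \<in> space M \<Longrightarrow> \<gamma> i \<omega> \<ge> 0"
    and \<gamma>_sum: "\<And>\<omega>. \<omega> \<in> space M \<Longrightarrow> ((\<lambda>i. \<gamma> i \<omega>) has_sum 1) {1..}"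
    and g_nonneg: "\<And>j i \<omega>. 1 \<le> j \<Longrightarrow> j < i \<Longrightarrow> \<omega> \<in> space M \<Longrightarrow> g j i \<omega> \<ge> 0"
    and g_conflict: "\<And>j i \<omega>. 1 \<le> j \<Longrightarrow> j < i \<Longrightarrow> j \<in> X i \<Longrightarrow> \<omega> \<in> space M \<Longrightarrow> g j i \<omega> = 0"
    and g_summable: "\<And>j \<omega>. 1 \<le> j \<Longrightarrow> \<omega> \<in> space M \<Longrightarrow>
      (\<lambda>i. g j i \<omega>) summable_on {i. j < i \<and> j \<notin> X i}"
    and g_sum: "\<And>j \<omega>. 1 \<le> j \<Longrightarrow> \<omega> \<in> space M \<Longrightarrow>
      (\<Sum>\<^sub>\<infinity>i | j < i \<and> j \<notin> X i. g j i \<omega>) \<le> 1"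
    and \<tau>_range: "\<And>i \<omega>. i \<ge> 1 \<Longrightarrow> \<omega> \<in> space M \<Longrightarrow> \<tau> i \<omega> \<in> {0<..1}"
    and lam_range: "\<And>i \<omega>. i \<ge> 1 \<Longrightarrow> \<omega> \<in> space M \<Longrightarrow> lam i \<omega> \<in> {0..<\<tau> i \<omega>}"
    and \<gamma>_meas: "\<And>i. i \<ge> 1 \<Longrightarrow> \<gamma> i \<in> borel_measurable (nonconflict_algebra M P X i)"
    and g_meas: "\<And>j i. 1 \<le> j \<Longrightarrow> j < i \<Longrightarrow>
      g j i \<in> borel_measurable (nonconflict_algebra M P X i)"
    and \<tau>_meas: "\<And>i. i \<ge> 1 \<Longrightarrow> \<tau> i \<in> borel_measurable (nonconflict_algebra M P X i)"
    and lam_meas: "\<And>i. i \<ge> 1 \<Longrightarrow> lam i \<in> borel_measurable (nonconflict_algebra M P X i)"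
  shows "fwer M P I0 (addis_graph_conf \<alpha> P \<gamma> g \<tau> lam) \<le> \<alpha>"
proof -
  interpret prob_space M by fact
  define G where "G i = nonconflict_algebra M P X i" for i
  define a where "a = addis_graph_conf \<alpha> P \<gamma> g \<tau> lam"
  define b where "b i \<omega> = a i \<omega> / (\<tau> i \<omega> - lam i \<omega>)" for i \<omega>
  define w :: "nat \<Rightarrow> 'a \<Rightarrow> real"
    where "w j \<omega> = of_bool (P j \<omega> \<le> lam j \<omega>) - of_bool (P j \<omega> \<le> \<tau> j \<omega>) + 1" for j \<omega>
  define U :: "nat \<Rightarrow> 'a \<Rightarrow> real"
    where "U j \<omega> = of_bool (lam j \<omega> < P j \<omega> \<and> P j \<omega> \<le> \<tau> j \<omega>)" for j \<omega>
  have G: "subalgebra M (G i)" for i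
    unfolding G_def using pval_rv by (rule subalgebra_nonconflict_algebra)
  \<comment> \<open>Since \<open>lam i \<omega> < \<tau> i \<omega>\<close>, the factor
    \<open>w\<close> is 0 on the absorption event and 1 elsewhere.\<close>
  have wU: "1 - w i \<omega> = U i \<omega>" if "i \<ge> 1" "\<omega> \<in> space M" for i \<omega>
    using lam_range[OF that] by (auto simp: w_def U_def)
  have w_nonneg: "0 \<le> w i \<omega>" if "i \<ge> 1" "\<omega> \<in> space M" for i \<omega>
    using wU[OF that] by (cases "U i \<omega> = 0") (auto simp: U_def)
  \<comment> \<open>Dividing by the positive \<open>\<tau> i \<omega> - lam i \<omega>\<close>
    brings the recursion into the form of \<open>flow_bound\<close>.\<close>
  have b_rec: "b i \<omega> = \<alpha> * \<gamma> i \<omega> + (\<Sum>j=1..<i. g j i \<omega> * w j \<omega> * b j \<omega>)"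
    if "i \<ge> 1" "\<omega> \<in> space M" for i \<omega>
    using lam_range[OF that] unfolding b_def a_def w_def
    by (subst addis_graph_conf.simps) auto
  have b_nonneg: "0 \<le> b i \<omega>" if "i \<ge> 1" "\<omega> \<in> space M" for i \<omega>
    using that(1)
  proof (induction i rule: less_induct)
    case (less i)
    then show ?case
      using that \<alpha> \<gamma>_nonneg g_nonneg w_nonneg
      by (subst b_rec) (auto intro!: add_nonneg_nonneg sum_nonneg mult_nonneg_nonneg)
  qed
  have b_bound: "(\<Sum>i=1..<n. U i \<omega> * b i \<omega>) + b n \<omega> \<le> \<alpha>" if "n \<ge> 1" "\<omega> \<in> space M" for n \<omega>
  proof -
    have "(\<Sum>i=1..<n. (1 - w i \<omega>) * b i \<omega>) + b n \<omega> \<le> \<alpha>"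
    proof (rule flow_bound)
      have "(\<Sum>i=1..n. \<gamma> i \<omega>) \<le> 1"
        using that \<gamma>_nonneg by (intro finite_sum_le_has_sum[OF \<gamma>_sum]) auto
      then show "(\<Sum>i=1..n. \<alpha> * \<gamma> i \<omega>) \<le> \<alpha>"
        using \<alpha> by (simp flip: sum_distrib_left add: mult_left_le)
    next
      fix j assume j: "j \<in> {1..<n}"
      \<comment> \<open>Weights on conflicting edges vanish, so the finite sum is a partial sum of
        the infinite one.\<close>
      have "(\<Sum>i\<in>{j<..n}. g j i \<omega>) = (\<Sum>i\<in>{j<..n} \<inter> {i. j < i \<and> j \<notin> X i}. g j i \<omega>)"
        using j that g_conflict by (intro sum.mono_neutral_right) auto
      also have "\<dots> \<le> (\<Sum>\<^sub>\<infinity>i | j < i \<and> j \<notin> X i. g j i \<omega>)"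
        using j that g_nonneg by (intro finite_sum_le_infsum g_summable) auto
      also have "\<dots> \<le> 1"
        using j that by (intro g_sum) auto
      finally show "(\<Sum>i\<in>{j<..n}. g j i \<omega>) \<le> 1" .
    qed (use that b_rec b_nonneg w_nonneg in auto)
    also have "(\<Sum>i=1..<n. (1 - w i \<omega>) * b i \<omega>) = (\<Sum>i=1..<n. U i \<omega> * b i \<omega>)"
      using that wU by (intro sum.cong) auto
    finally show ?thesis .
  qed
  \<comment> \<open>Dropping the absorbed mass from \<open>b_bound\<close> leaves
    \<open>b i \<omega> \<le> \<alpha> < 1\<close>. The unit interval is required because
    \<open>b\<close> serves as part of a scaling factor in the validity bound.\<close>
  have b_range: "b i \<omega> \<in> {0..1}" if "i \<ge> 1" "\<omega> \<in> space M" for i \<omega>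
  proof -
    have "0 \<le> (\<Sum>j=1..<i. U j \<omega> * b j \<omega>)"
      using that b_nonneg by (intro sum_nonneg) (auto simp: U_def)
    then show ?thesis using b_bound[OF that] b_nonneg[OF that] \<alpha> by auto
  qed
  \<comment> \<open>Only indices \<open>j\<close> outside \<open>X i\<close> contribute, since
    \<open>g j i\<close> vanishes on conflicts. For these, \<open>P j\<close> is a generator of
    \<open>G i\<close>, and everything known to \<open>G j\<close>, including \<open>b j\<close> by
    induction, is known to \<open>G i\<close>.\<close>
  have b_meas: "b i \<in> borel_measurable (G i)" if "i \<ge> 1" for i
    using that
  proof (induction i rule: less_induct)
    case (less i)
    have [measurable]: "\<gamma> i \<in> borel_measurable (G i)"
      unfolding G_def using less.prems by (rule \<gamma>_meas)
    have "(\<lambda>\<omega>. g j i \<omega> * w j \<omega> * b j \<omega>) \<in> borel_measurable (G i)" if j: "j \<in> {1..<i} - X i" for j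
    proof -
      have mono: "f \<in> borel_measurable (G i)" if "f \<in> borel_measurable (G j)" for f :: "'a \<Rightarrow> real"
        using that j monotone borel_measurable_nonconflict_algebra_mono unfolding G_def by blast
      have [measurable]: "b j \<in> borel_measurable (G i)" "\<tau> j \<in> borel_measurable (G i)"
        "lam j \<in> borel_measurable (G i)"
        using j less.IH \<tau>_meas lam_meas by (auto simp: G_def[symmetric] intro!: mono)
      have [measurable]: "P j \<in> borel_measurable (G i)" "g j i \<in> borel_measurable (G i)"
        using j unfolding G_def by (auto intro!: measurable_nonconflict_algebra g_meas)
      show ?thesis unfolding w_def of_bool_def by measurable
    qed
    then have "(\<lambda>\<omega>. \<alpha> * \<gamma> i \<omega> + (\<Sum>j\<in>{1..<i} - X i. g j i \<omega> * w j \<omega> * b j \<omega>))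
        \<in> borel_measurable (G i)"
      by (intro borel_measurable_add borel_measurable_sum) simp_all
    also have "?this \<longleftrightarrow> ?case"
    proof (rule measurable_cong)
      fix \<omega> assume "\<omega> \<in> space (G i)"
      then have \<omega>: "\<omega> \<in> space M" by (simp add: G_def space_nonconflict_algebra)
      have "(\<Sum>j=1..<i. g j i \<omega> * w j \<omega> * b j \<omega>)
          = (\<Sum>j\<in>{1..<i} - X i. g j i \<omega> * w j \<omega> * b j \<omega>)"
        using \<omega> g_conflict by (intro sum.mono_neutral_right) auto
      then show "\<alpha> * \<gamma> i \<omega> + (\<Sum>j\<in>{1..<i} - X i. g j i \<omega> * w j \<omega> * b j \<omega>) = b i \<omega>"
        using b_rec[OF less.prems \<omega>] by simp
    qed
    finally show ?case .
  qed
  have [measurable]: "P i \<in> borel_measurable M" "\<tau> i \<in> borel_measurable M"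
    "lam i \<in> borel_measurable M" "b i \<in> borel_measurable M" if "i \<ge> 1" for i
    using pval_rv[OF that] \<tau>_meas[OF that] lam_meas[OF that] b_meas[OF that]
    by (auto intro: measurable_from_subalg[OF G] simp: G_def)
  have U_meas: "(\<lambda>\<omega>. U i \<omega> * b i \<omega>) \<in> borel_measurable M" if [simp, measurable]: "i \<ge> 1" for i
    unfolding U_def of_bool_def by measurable
  \<comment> \<open>Keeping \<open>i \<in> I0\<close> inside the event makes \<open>R i\<close>
    empty for false nulls and for index 0, so the union bound can run over all naturals.\<close>
  define R where "R i = {\<omega>\<in>space M. i \<in> I0 \<and> P i \<omega> \<le> a i \<omega>}" for i
  have R_eq: "R i = {\<omega>\<in>space M. P i \<omega> \<le> (\<tau> i \<omega> - lam i \<omega>) * b i \<omega>}" if i: "i \<in> I0" for i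
  proof -
    have "i \<ge> 1" using i nulls by auto
    then show ?thesis using i lam_range unfolding R_def b_def by force
  qed
  have R_meas: "R i \<in> sets M" for i
  proof (cases "i \<in> I0")
    case True
    then have [measurable]: "i \<ge> 1" using nulls by auto
    show ?thesis unfolding R_eq[OF True] by measurable
  qed (simp add: R_def)
  have R_le: "emeasure M (R i) \<le> (\<integral>\<^sup>+\<omega>. ennreal (U i \<omega> * b i \<omega>) \<partial>M)" if i: "i \<ge> 1" for i
  proof (cases "i \<in> I0")
    case True
    have "uniformly_valid_pval M (P i) \<or> (AE \<omega> in M. \<tau> i \<omega> = 1) \<and> valid_pval M (P i)"
      using True null_valid null_uniformly_valid by blast
    then show ?thesis
      unfolding R_eq[OF True] U_def
      using i indep G b_meas b_range \<tau>_range lam_range \<tau>_meas lam_meas pval_rv pval_range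
      by (intro prob_rejection_le[where G = "G i"]) (auto simp: G_def)
  qed (simp add: R_def)
  \<comment> \<open>Partial sums suffice, and they match the finite horizon of
    \<open>b_bound\<close>.\<close>
  have "(\<Sum>i<n. emeasure M (R i)) \<le> ennreal \<alpha>" for n
  proof -
    have "R 0 = {}" using nulls by (auto simp: R_def)
    then have "(\<Sum>i<n. emeasure M (R i)) = (\<Sum>i=1..<n. emeasure M (R i))"
      by (intro sum.mono_neutral_cong_right) (auto simp: not_le less_Suc_eq)
    also have "\<dots> \<le> (\<Sum>i=1..<n. \<integral>\<^sup>+\<omega>. ennreal (U i \<omega> * b i \<omega>) \<partial>M)"
      by (intro sum_mono R_le) auto
    also have "\<dots> = (\<integral>\<^sup>+\<omega>. (\<Sum>i=1..<n. ennreal (U i \<omega> * b i \<omega>)) \<partial>M)"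
      using U_meas by (intro nn_integral_sum[symmetric]) auto
    also have "\<dots> \<le> (\<integral>\<^sup>+\<omega>. ennreal \<alpha> \<partial>M)"
    proof (rule nn_integral_mono)
      fix \<omega> assume \<omega>: "\<omega> \<in> space M"
      have "(\<Sum>i=1..<n. ennreal (U i \<omega> * b i \<omega>)) = ennreal (\<Sum>i=1..<n. U i \<omega> * b i \<omega>)"
        using \<omega> b_nonneg by (intro sum_ennreal) (auto simp: U_def)
      also have "\<dots> \<le> ennreal \<alpha>"
      \<comment> \<open>The extra term \<open>b n \<omega>\<close> in \<open>b_bound\<close> is
        dropped as nonnegative. That bound needs \<open>n \<ge> 1\<close>; for \<open>n = 0\<close>
        the sum is empty.\<close>
      proof (cases "n \<ge> 1")
        case True
        then show ?thesis
          using b_bound[OF True \<omega>] b_nonneg[OF True \<omega>] by (intro ennreal_leI) linarith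
      qed (simp add: not_le)
      finally show "(\<Sum>i=1..<n. ennreal (U i \<omega> * b i \<omega>)) \<le> ennreal \<alpha>" .
    qed
    also have "\<dots> = ennreal \<alpha>" by (simp add: emeasure_space_1)
    finally show ?thesis .
  qed
  then have "(\<Sum>i. emeasure M (R i)) \<le> ennreal \<alpha>"
    by (intro suminf_le_const) auto
  moreover have "emeasure M (\<Union>i. R i) \<le> (\<Sum>i. emeasure M (R i))"
    using R_meas by (intro emeasure_subadditive_countably) auto
  ultimately have "emeasure M (\<Union>i. R i) \<le> ennreal \<alpha>" by simp
  moreover have "(\<Union>i. R i) = {\<omega>\<in>space M. \<exists>i\<in>I0. P i \<omega> \<le> a i \<omega>}"
    by (auto simp: R_def)
  ultimately show ?thesis
    using \<alpha> unfolding fwer_def a_def[symmetric] by (simp add: emeasure_eq_measure)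
qed

end
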